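(* Let $\rho>2H$, and let $(x_1^k,\dots,x_n^k,z^k,y^k)_{k\ge0}$ be a sequence generated by the ADMM iteration described in the context. Suppose that either of the following two assumptions holds: (a) $A_i$ ($i=1,\dots,n$) have full rank; (b) $F$ is strongly convex with regard to $x_i$ ($i=1,\dots,n$). Then, for bounded variables $(x_1^k,\dots,x_n^k,z^k)$, the sequence $(x_1^k,\dots,x_n^k,z^k)_k$ has at least one limit point, and any limit point $(x_1^*,\dots,x_n^*,z^* )$ is a feasible Nash point of $F$, that is: (feasibility) $\sum_{i=1}^nA_ix_i^*-z^*=0$; (Nash point) for each $i=1,\dots,n$, $F(x_1^*,\dots,x_n^*,z^* )\le F(x_1^*,\dots,x_{i-1}^*,x_i,x_{i+1}^*,\dots,x_n^*,z^* )$ for all $(x_1^*,\dots,x_{i-1}^*,x_i,x_{i+1}^*,\dots,x_n^*,z^* )\in dom(F)$; and $F(x_1^*,\dots,x_n^*,z^* )\le F(x_1^*,\dots,x_n^*,z)$ for all $(x_1^*,\dots,x_n^*,z)\in dom(F)$.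
   Context: Problem: minimize $F(x_1,\dots,x_n,z)=f(x_1,\dots,x_n)+h(z)$ over $x_i\in\mathbb{R}^{p_i}$ ($i=1,\dots,n$), $z\in\mathbb{R}^q$, subject to $\sum_{i=1}^n A_ix_i-z=0$, where $A_i\in\mathbb{R}^{q\times p_i}$ are matrices; $f:\mathbb{R}^p\to\mathbb{R}\cup\{\infty\}$ ($p=\sum_i p_i$) is proper, continuous, possibly nonsmooth, and multi-convex (i.e. convex in each $x_i$ when all the other variables are fixed); $h$ is a proper, differentiable and convex function on $\mathbb{R}^q$. By convention $dom(F)=\{(x_1,\dots,x_n,z): \sum_{i=1}^nA_ix_i-z=0\}$. Standing assumptions: the objective of the problem is bounded from below; $h$ is Lipschitz differentiable with constant $H\ge 0$, i.e. $\|\nabla h(z')-\nabla h(z'')\|\le H\|z'-z''\|$ for all $z',z''\in\mathbb{R}^q$; the problem has at least one Nash point (a point satisfying the Nash inequalities displayed in the claim). Strong convexity: a convex function $G$ is strongly convex if there exists $D>0$ such that $G(x'')\ge G(x')+v^T(x''-x')+\frac{D}{2}\|x''-x'\|_2^2$ for all $x',x''\in dom(G)$ and all subgradients $v\in\partial G(x')$. "With regard to $x_i$" refers to $F$ as a function of $x_i$ with the other variables fixed. Augmented Lagrangian, for a penalty parameter $\rho>0$ and dual variable $y\in\mathbb{R}^q$: $L_\rho(x_1,\dots,x_n,z,y)=F(x_1,\dots,x_n,z)+y^T(\sum_{i=1}^nA_ix_i-z)+\frac{\rho}{2}\|\sum_{i=1}^nA_ix_i-z\|_2^2$, where $F=f+h$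 is evaluated by its formula, also at infeasible points. ADMM iteration (run indefinitely, from an initial point $(x_1^0,\dots,x_n^0,z^0,y^0)$): for $k=0,1,2,\dots$, first for $i=1,\dots,n$ in order, $x_i^{k+1}$ is a minimizer over $x_i$ of $L_\rho(x_1^{k+1},\dots,x_{i-1}^{k+1},x_i,x_{i+1}^k,\dots,x_n^k,z^k,y^k)$; then $z^{k+1}$ is a minimizer over $z$ of $L_\rho(x_1^{k+1},\dots,x_n^{k+1},z,y^k)$; then $r^{k+1}=\sum_{i=1}^nA_ix_i^{k+1}-z^{k+1}$ and $y^{k+1}=y^k+\rho r^{k+1}$. Each subproblem is assumed to be solvable. *)

theory Defs
  imports "HOL-Analysis.Analysis"
begin

section \<open>Vectors and matrices split into blocks\<close>

text \<open>
  The blocks \<open>x\<^sub>1, \<dots>, x\<^sub>n\<close> may have different dimensions \<open>p\<^sub>1, \<dots>, p\<^sub>n\<close>.  The stacked vector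
  \<open>(x\<^sub>1, \<dots>, x\<^sub>n)\<close> is an element of \<open>real^'p\<close>, where \<open>CARD('p) = p\<^sub>1 + \<dots> + p\<^sub>n\<close>, and a map
  \<open>b :: 'p \<Rightarrow> nat\<close> with \<open>range b \<subseteq> {1..n}\<close> tells to which block a coordinate belongs, so that
  \<open>p\<^sub>i = card {j. b j = i}\<close>.  The \<open>i\<close>-th factor \<open>\<real>\<^bsup>p\<^sub>i\<^esup>\<close> is identified with the subspace of the
  vectors that vanish outside block \<open>i\<close>.  The matrices \<open>A\<^sub>1, \<dots>, A\<^sub>n\<close> are the column blocks of
  one matrix \<open>A = [A\<^sub>1 \<dots> A\<^sub>n]\<close>.
\<close>

definition block_space :: "('p::finite \<Rightarrow> nat) \<Rightarrow> nat \<Rightarrow> (real^'p) set" where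
  "block_space b i = {u. \<forall>j. b j \<noteq> i \<longrightarrow> u $ j = 0}"

definition block :: "('p::finite \<Rightarrow> nat) \<Rightarrow> nat \<Rightarrow> real^'p \<Rightarrow> real^'p" where
  "block b i x = (\<chi> j. if b j = i then x $ j else 0)"

text \<open>\<open>put_block b i x u\<close> is \<open>(x\<^sub>1, \<dots>, x\<^bsub>i-1\<^esub>, u, x\<^bsub>i+1\<^esub>, \<dots>, x\<^sub>n)\<close>.\<close>

definition put_block :: "('p::finite \<Rightarrow> nat) \<Rightarrow> nat \<Rightarrow> real^'p \<Rightarrow> real^'p \<Rightarrow> real^'p" where
  "put_block b i x u = (\<chi> j. if b j = i then u $ j else x $ j)"

text \<open>\<open>sweep_point b i x' x\<close> is \<open>(x'\<^sub>1, \<dots>, x'\<^bsub>i-1\<^esub>, x\<^sub>i, x\<^bsub>i+1\<^esub>, \<dots>, x\<^sub>n)\<close>.\<close>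

definition sweep_point :: "('p::finite \<Rightarrow> nat) \<Rightarrow> nat \<Rightarrow> real^'p \<Rightarrow> real^'p \<Rightarrow> real^'p" where
  "sweep_point b i x' x = (\<chi> j. if b j < i then x' $ j else x $ j)"

text \<open>
  The \<open>q \<times> p\<close> matrix whose columns in block \<open>i\<close> are those of \<open>A\<^sub>i\<close> and whose other columns are
  zero.  It has the rank of \<open>A\<^sub>i\<close>, and it acts on \<open>block_space b i\<close> as \<open>A\<^sub>i\<close> does on \<open>\<real>\<^bsup>p\<^sub>i\<^esup>\<close>.
\<close>

definition block_matrix ::
    "('p::finite \<Rightarrow> nat) \<Rightarrow> nat \<Rightarrow> real^'p^'q \<Rightarrow> real^'p^'q" where
  "block_matrix b i A = (\<chi> r c. if b c = i then A $ r $ c else 0)"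

definition residual ::
    "('p::finite \<Rightarrow> nat) \<Rightarrow> nat \<Rightarrow> real^'p^'q \<Rightarrow> real^'p \<Rightarrow> real^'q \<Rightarrow> real^'q" where
  "residual b n A x z = (\<Sum>i = 1..n. block_matrix b i A *v block b i x) - z"

lemma put_block_block [simp]: "put_block b i x (block b i x) = x"
  by (simp add: put_block_def block_def vec_eq_iff)

lemma residual_eq:
  assumes "range b \<subseteq> {1..n}"
  shows "residual b n A x z = A *v x - z"
proof -
  have *: "b c \<in> {1..n}" for c
    using assms by (rule subsetD) simp
  have "(\<Sum>i = 1..n. block_matrix b i A *v block b i x) $ r = (A *v x) $ r" for r
  proof -
    have "(\<Sum>i = 1..n. block_matrix b i A *v block b i x) $ r
        = (\<Sum>c\<in>UNIV. \<Sum>i = 1..n. if i = b c then A $ r $ c * x $ c else 0)"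
      by (subst sum.swap)
        (auto simp: block_matrix_def block_def matrix_vector_mult_def intro!: sum.cong)
    also have "\<dots> = (\<Sum>c\<in>UNIV. A $ r $ c * x $ c)"
      using * by (simp add: sum.delta)
    finally show ?thesis
      by (simp add: matrix_vector_mult_def)
  qed
  then show ?thesis
    by (simp add: residual_def vec_eq_iff)
qed


section \<open>Extended-real-valued convex functions\<close>

definition proper :: "('a \<Rightarrow> ereal) \<Rightarrow> bool" where
  "proper g \<longleftrightarrow> (\<forall>u. g u \<noteq> -\<infinity>) \<and> (\<exists>u. g u \<noteq> \<infinity>)"

text \<open>Only used for \<open>g > -\<infinity>\<close>; note that \<open>0 * \<infinity> = 0\<close> in \<open>ereal\<close>.\<close>

definition ereal_convex_on :: "'a::real_vector set \<Rightarrow> ('a \<Rightarrow> ereal) \<Rightarrow> bool" where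
  "ereal_convex_on S g \<longleftrightarrow>
     (\<forall>u\<in>S. \<forall>w\<in>S. \<forall>t\<in>{0..1}.
        g ((1 - t) *\<^sub>R u + t *\<^sub>R w) \<le> ereal (1 - t) * g u + ereal t * g w)"

definition subdifferential_on :: "'a::real_inner set \<Rightarrow> ('a \<Rightarrow> ereal) \<Rightarrow> 'a \<Rightarrow> 'a set" where
  "subdifferential_on S g u = {v \<in> S. \<forall>w\<in>S. g u + ereal (v \<bullet> (w - u)) \<le> g w}"

text \<open>\<open>S\<close> is a linear subspace here, and \<open>dom g\<close> is the effective domain \<open>{u \<in> S. g u < \<infinity>}\<close>.\<close>

definition strongly_convex_on :: "'a::real_inner set \<Rightarrow> ('a \<Rightarrow> ereal) \<Rightarrow> bool" where
  "strongly_convex_on S g \<longleftrightarrow>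
     ereal_convex_on S g \<and>
     (\<exists>D>0. \<forall>u\<in>S. \<forall>w\<in>S. g u < \<infinity> \<longrightarrow> g w < \<infinity> \<longrightarrow>
        (\<forall>v\<in>subdifferential_on S g u.
           g u + ereal (v \<bullet> (w - u)) + ereal (D / 2 * (norm (w - u))\<^sup>2) \<le> g w))"

definition multi_convex :: "('p::finite \<Rightarrow> nat) \<Rightarrow> nat \<Rightarrow> (real^'p \<Rightarrow> ereal) \<Rightarrow> bool" where
  "multi_convex b n f \<longleftrightarrow>
     (\<forall>i\<in>{1..n}. \<forall>x. ereal_convex_on (block_space b i) (\<lambda>u. f (put_block b i x u)))"

text \<open>
  A minimizer of an extended-real-valued function must have a finite value: the constant function
  \<open>\<infinity>\<close> has no minimizer.
\<close>

definition minimizer_on :: "'a set \<Rightarrow> ('a \<Rightarrow> ereal) \<Rightarrow> 'a \<Rightarrow> bool" where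
  "minimizer_on S g u \<longleftrightarrow> is_arg_min g (\<lambda>v. v \<in> S) u \<and> g u < \<infinity>"


section \<open>The problem and the ADMM iteration\<close>

definition objective ::
    "(real^'p \<Rightarrow> ereal) \<Rightarrow> (real^'q \<Rightarrow> real) \<Rightarrow> real^'p \<Rightarrow> real^'q \<Rightarrow> ereal" where
  "objective f h x z = f x + ereal (h z)"

definition feasible ::
    "('p::finite \<Rightarrow> nat) \<Rightarrow> nat \<Rightarrow> real^'p^'q \<Rightarrow> real^'p \<Rightarrow> real^'q \<Rightarrow> bool" where
  "feasible b n A x z \<longleftrightarrow> residual b n A x z = 0"

text \<open>
  The competitors range over \<open>dom(F)\<close>, which by convention is the set of feasible points.
  A Nash point is not required to be feasible itself.
\<close>

definition nash_point ::
    "('p::finite \<Rightarrow> nat) \<Rightarrow> nat \<Rightarrow> real^'p^'q \<Rightarrow> (real^'p \<Rightarrow> ereal) \<Rightarrow> (real^'q \<Rightarrow> real)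
      \<Rightarrow> real^'p \<Rightarrow> real^'q \<Rightarrow> bool" where
  "nash_point b n A f h x z \<longleftrightarrow>
     (\<forall>i\<in>{1..n}. \<forall>u\<in>block_space b i.
        feasible b n A (put_block b i x u) z \<longrightarrow>
        objective f h x z \<le> objective f h (put_block b i x u) z) \<and>
     (\<forall>z'. feasible b n A x z' \<longrightarrow> objective f h x z \<le> objective f h x z')"

definition aug_lagrangian ::
    "('p::finite \<Rightarrow> nat) \<Rightarrow> nat \<Rightarrow> real^'p^'q \<Rightarrow> (real^'p \<Rightarrow> ereal) \<Rightarrow> (real^'q \<Rightarrow> real) \<Rightarrow> real
      \<Rightarrow> real^'p \<Rightarrow> real^'q \<Rightarrow> real^'q \<Rightarrow> ereal" where
  "aug_lagrangian b n A f h \<rho> x z y =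
     objective f h x z
     + ereal (y \<bullet> residual b n A x z + \<rho> / 2 * (norm (residual b n A x z))\<^sup>2)"

definition admm_sequence ::
    "('p::finite \<Rightarrow> nat) \<Rightarrow> nat \<Rightarrow> real^'p^'q \<Rightarrow> (real^'p \<Rightarrow> ereal) \<Rightarrow> (real^'q \<Rightarrow> real) \<Rightarrow> real
      \<Rightarrow> (nat \<Rightarrow> real^'p) \<Rightarrow> (nat \<Rightarrow> real^'q) \<Rightarrow> (nat \<Rightarrow> real^'q) \<Rightarrow> bool" where
  "admm_sequence b n A f h \<rho> x z y \<longleftrightarrow>
     (\<forall>k.
       (\<forall>i\<in>{1..n}.
          minimizer_on (block_space b i)
            (\<lambda>u. aug_lagrangian b n A f h \<rho>
                   (put_block b i (sweep_point b i (x (Suc k)) (x k)) u) (z k) (y k))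
            (block b i (x (Suc k)))) \<and>
       minimizer_on UNIV (\<lambda>w. aug_lagrangian b n A f h \<rho> (x (Suc k)) w (y k)) (z (Suc k)) \<and>
       y (Suc k) = y k + \<rho> *\<^sub>R residual b n A (x (Suc k)) (z (Suc k)))"

definition seq_limit_point :: "(nat \<Rightarrow> 'a::topological_space) \<Rightarrow> 'a \<Rightarrow> bool" where
  "seq_limit_point s l \<longleftrightarrow> (\<exists>r. strict_mono (r :: nat \<Rightarrow> nat) \<and> (s \<circ> r) \<longlonglongrightarrow> l)"

end

theory Submission
  imports Defs
begin

text \<open>
  Write \<open>L\<close> for the augmented Lagrangian.  From the first iterate on, \<open>L\<close> decreases.  The block
  updates cannot increase it.  The optimality condition of the \<open>z\<close>-update reads
  \<open>\<nabla>h(z\<^bsup>k+1\<^esup>) = y\<^bsup>k+1\<^esup>\<close>, and with convexity of \<open>h\<close> this makes \<open>L\<close> drop by at least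
  \<open>\<rho>/2 \<parallel>z\<^bsup>k+1\<^esup> - z\<^bsup>k\<^esup>\<parallel>\<^sup>2\<close>.  The dual update gives back \<open>\<rho> \<parallel>r\<^bsup>k+1\<^esup>\<parallel>\<^sup>2\<close>, which is at most
  \<open>H\<^sup>2/\<rho> \<parallel>z\<^bsup>k+1\<^esup> - z\<^bsup>k\<^esup>\<parallel>\<^sup>2\<close> since \<open>\<rho> r\<^bsup>k+1\<^esup>\<close> is a difference of gradients of \<open>h\<close>; as
  \<open>\<rho> > 2H\<close>, the gain outweighs the loss.  Along bounded iterates \<open>L\<close> is bounded below, so it
  converges to some \<open>l\<close>.  Hence \<open>z\<^bsup>k+1\<^esup> - z\<^bsup>k\<^esup> \<rightarrow> 0\<close>, \<open>r\<^bsup>k\<^esup> \<rightarrow> 0\<close> (limit points are feasible), and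
  the values of \<open>L\<close> at all points inside a sweep over the blocks tend to the same \<open>l\<close>
  (\<open>admm_lagrangian_limit\<close>).

  The rest is a compactness argument.  The modulus of strong convexity may depend on the point, so
  along the sequence there is no uniform estimate for \<open>x\<^bsup>k+1\<^esup> - x\<^bsup>k\<^esup>\<close>; strict convexity is used
  at the limit only.  Along a subsequence let \<open>x\<^bsup>k\<^esup> \<rightarrow> x\<^sup>*\<close> and \<open>x\<^bsup>k+1\<^esup> \<rightarrow> x'\<close>.  Suppose that
  the first \<open>i - 1\<close> blocks of \<open>x'\<close> and \<open>x\<^sup>*\<close> agree.  Since \<open>f\<close> is continuous, the minimality of
  the \<open>i\<close>-th update passes to the limit: \<open>x'\<^sub>i\<close> minimizes \<open>L\<close> over block \<open>i\<close> with the other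
  blocks taken from \<open>x\<^sup>*\<close>, and the minimum is \<open>l\<close>.  But \<open>L\<close> also has the value \<open>l\<close> at \<open>x\<^sup>*\<close>
  itself, so \<open>x\<^sup>*\<^sub>i\<close> is a minimizer too.  Minimizers are unique under either of the two
  assumptions (\<open>aug_lagrangian_block_minimizer_unique\<close>), so block \<open>i\<close> agrees as well.  By
  induction every block of \<open>x\<^sup>*\<close> minimizes \<open>L\<close> (\<open>limit_point_block_minimizer\<close>), and on feasible
  points \<open>L\<close> is the objective.  The Nash inequality in \<open>z\<close> is trivial, as \<open>z\<close> is determined by
  feasibility.
\<close>


section \<open>Blocks\<close>

lemma subspace_block_space: "subspace (block_space b i)"
  by (auto simp: block_space_def subspace_def)

lemma block_in_block_space [simp]: "block b i x \<in> block_space b i"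
  by (simp add: block_space_def block_def)

lemma put_block_eq:
  assumes "u \<in> block_space b i"
  shows "put_block b i x u = x + (u - block b i x)"
  using assms by (auto simp: put_block_def block_def block_space_def vec_eq_iff)

lemma put_block_sweep_point:
  "put_block b i (sweep_point b i x' x) (block b i x') = sweep_point b (Suc i) x' x"
  by (auto simp: put_block_def sweep_point_def block_def vec_eq_iff)

lemma sweep_point_first:
  assumes "range b \<subseteq> {1..n}"
  shows "sweep_point b 1 x' x = x"
proof -
  have "1 \<le> b j" for j using assms by (auto dest!: subsetD[OF _ rangeI[of b j]])
  then show ?thesis by (auto simp: sweep_point_def vec_eq_iff dest: leD)
qed

lemma sweep_point_last:
  assumes "range b \<subseteq> {1..n}"
  shows "sweep_point b (Suc n) x' x = x'"
proof -
  have "b j < Suc n" for j using assms by (auto dest!: subsetD[OF _ rangeI[of b j]])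
  then show ?thesis by (auto simp: sweep_point_def vec_eq_iff)
qed

lemma tendsto_put_block:
  assumes "(X \<longlongrightarrow> x) F"
  shows "((\<lambda>k. put_block b i (X k) u) \<longlongrightarrow> put_block b i x u) F"
  by (rule vec_tendstoI) (auto simp: put_block_def intro!: tendsto_vec_nth assms)

lemma tendsto_sweep_point:
  assumes "(X' \<longlongrightarrow> x') F" "(X \<longlongrightarrow> x) F"
  shows "((\<lambda>k. sweep_point b i (X' k) (X k)) \<longlongrightarrow> sweep_point b i x' x) F"
  by (rule vec_tendstoI) (auto simp: sweep_point_def intro!: tendsto_vec_nth assms)

lemma inner_block:
  assumes "w \<in> block_space b i"
  shows "block b i v \<bullet> w = v \<bullet> w"
  using assms by (auto simp: inner_vec_def block_def block_space_def intro!: sum.cong)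

text \<open>
  The row space of \<open>A\<^sub>i\<close> lies in block \<open>i\<close> and has the dimension of that block, so it is the
  whole block.  A kernel vector is orthogonal to all rows, hence to itself.
\<close>

lemma full_rank_block_kernel:
  fixes A :: "real^'p^'q"
  assumes rank: "rank (block_matrix b i A) = card {j. b j = i}"
    and u: "u \<in> block_space b i" and Au: "A *v u = 0"
  shows "u = 0"
proof -
  let ?B = "block_matrix b i A"
  have "dim (block_space b i :: (real^'p) set) = card {j. b j = i}"
  proof -
    have "vec.dim {x :: real^'p. \<forall>j. j \<notin> {j. b j = i} \<longrightarrow> x $ j = 0} = card {j. b j = i}"
      by (rule dim_substandard_cart)
    then show ?thesis by (simp add: block_space_def dim_vec_eq)
  qed
  moreover have rows: "rows ?B \<subseteq> block_space b i"
    by (auto simp: rows_def row_def block_matrix_def block_space_def)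
  moreover have "dim (rows ?B) = card {j. b j = i}"
    using rank by (simp add: row_rank_def)
  ultimately have "span (rows ?B) = span (block_space b i)"
    by (intro dim_eq_span) auto
  then have "u \<in> span (rows ?B)"
    using u by (simp add: span_base)
  moreover have "orthogonal u v" if v: "v \<in> rows ?B" for v
  proof -
    obtain r where r: "v = row r ?B" using v unfolding rows_def by blast
    have "u \<bullet> v = (A *v u) $ r"
      using u unfolding r
      by (auto simp: inner_vec_def row_def block_matrix_def block_space_def
          matrix_vector_mult_def intro!: sum.cong)
    then show ?thesis by (simp add: Au orthogonal_def)
  qed
  ultimately have "orthogonal u u"
    by (meson orthogonal_to_span)
  then show ?thesis by (simp add: orthogonal_self)
qed

section \<open>Minimizers of convex functions plus a quadratic\<close>

lemma norm_sq_expand: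
  fixes a c :: "'a::real_inner"
  shows "(norm (a + t *\<^sub>R c))\<^sup>2 = (norm a)\<^sup>2 + 2 * t * (a \<bullet> c) + t\<^sup>2 * (norm c)\<^sup>2"
  unfolding power2_norm_eq_inner
  by (simp add: inner_add_left inner_add_right inner_commute power2_eq_square algebra_simps)

definition penalty :: "real \<Rightarrow> 'q::real_inner \<Rightarrow> 'q \<Rightarrow> real" where
  "penalty \<rho> y r = y \<bullet> r + \<rho> / 2 * (norm r)\<^sup>2"

lemma penalty_line:
  "penalty \<rho> y (r + t *\<^sub>R s)
   = penalty \<rho> y r + t * ((y + \<rho> *\<^sub>R r) \<bullet> s) + t\<^sup>2 * (\<rho> / 2 * (norm s)\<^sup>2)"
  by (simp add: penalty_def norm_sq_expand inner_add_left inner_add_right algebra_simps add_divide_distrib)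

text \<open>
  A quadratic is strictly convex along the directions that its linear part sees: at the midpoint
  of two minimizers the value would otherwise fall below the minimum.
\<close>

lemma minimizers_have_same_image:
  fixes g :: "'a::real_vector \<Rightarrow> ereal" and M :: "'a \<Rightarrow> 'q::real_inner"
  assumes g: "ereal_convex_on S g" and S: "convex S" and fin: "\<And>v. g v \<noteq> -\<infinity>" "g u < \<infinity>" "g w < \<infinity>"
    and M: "linear M" and \<rho>: "\<rho> > 0" and uw: "u \<in> S" "w \<in> S"
    and min_u: "\<And>v. v \<in> S \<Longrightarrow> g u + ereal (penalty \<rho> y (M u + d)) \<le> g v + ereal (penalty \<rho> y (M v + d))"
    and min_w: "\<And>v. v \<in> S \<Longrightarrow> g w + ereal (penalty \<rho> y (M w + d)) \<le> g v + ereal (penalty \<rho> y (M v + d))"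
  shows "M (w - u) = 0"
proof -
  obtain a where a: "g u = ereal a" using fin by (cases "g u") auto
  obtain c where c: "g w = ereal c" using fin by (cases "g w") auto
  define m where "m = (1 - 1/2) *\<^sub>R u + (1/2) *\<^sub>R w"
  have m: "m \<in> S" unfolding m_def using S uw by (intro convexD) auto
  have "g m \<le> ereal (1 - 1/2) * g u + ereal (1/2) * g w"
    unfolding m_def using g uw
    by (intro g[unfolded ereal_convex_on_def, rule_format]) auto
  then have gm: "g m \<le> ereal (a / 2 + c / 2)" by (simp add: a c)
  define s where "s = M (w - u)"
  have Mw: "M w + d = (M u + d) + 1 *\<^sub>R s"
    unfolding s_def using M by (simp add: linear_diff)
  have "M m = M u + (1/2) *\<^sub>R s"
    unfolding s_def m_def using M by (simp add: linear_diff linear_add linear_scale algebra_simps flip: scaleR_add_left)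
  then have Mm: "M m + d = (M u + d) + (1/2) *\<^sub>R s"
    by simp
  have fold: "g m + ereal p \<le> ereal (a / 2 + c / 2 + p)" for p
    using add_right_mono[OF gm, of "ereal p"] by simp
  have "a + penalty \<rho> y (M u + d) \<le> a / 2 + c / 2 + penalty \<rho> y (M m + d)"
    using order_trans[OF min_u[OF m] fold] by (simp add: a)
  moreover have "c + penalty \<rho> y (M w + d) \<le> a / 2 + c / 2 + penalty \<rho> y (M m + d)"
    using order_trans[OF min_w[OF m] fold] by (simp add: c)
  ultimately have "\<rho> * (norm s)\<^sup>2 \<le> 0"
    unfolding Mw Mm penalty_line by (simp add: power2_eq_square field_simps)
  then show ?thesis
    using \<rho> unfolding s_def by (simp add: mult_le_0_iff)
qed

text \<open>
  Fermat's rule for the sum of a convex function and a smooth one: the negative gradient of the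
  penalty at a minimizer is a subgradient of \<open>g\<close>.  Comparing with points on the segment to \<open>w\<close>
  and letting them tend to \<open>u\<close> removes the second-order term.
\<close>

lemma minimizer_subgradient:
  fixes g :: "'a::real_inner \<Rightarrow> ereal" and M :: "'a \<Rightarrow> 'q::real_inner"
  assumes g: "ereal_convex_on S g" and S: "convex S" and fin: "\<And>v. g v \<noteq> -\<infinity>" "g u < \<infinity>"
    and M: "linear M" and u: "u \<in> S"
    and min_u: "\<And>v. v \<in> S \<Longrightarrow> g u + ereal (penalty \<rho> y (M u + d)) \<le> g v + ereal (penalty \<rho> y (M v + d))"
    and w: "w \<in> S"
  shows "g u + ereal (- ((y + \<rho> *\<^sub>R (M u + d)) \<bullet> M (w - u))) \<le> g w"
proof (cases "g w = \<infinity>")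
  case False
  then obtain c where c: "g w = ereal c" using fin by (cases "g w") auto
  obtain a where a: "g u = ereal a" using fin by (cases "g u") auto
  define s where "s = M (w - u)"
  define p where "p = (y + \<rho> *\<^sub>R (M u + d)) \<bullet> s"
  define q where "q = \<rho> / 2 * (norm s)\<^sup>2"
  have le: "a - c \<le> p + t * q" if t: "0 < t" "t < 1" for t
  proof -
    define m where "m = (1 - t) *\<^sub>R u + t *\<^sub>R w"
    have m: "m \<in> S" unfolding m_def using S u w t by (intro convexD) auto
    have "g m \<le> ereal (1 - t) * g u + ereal t * g w"
      using g u w t unfolding ereal_convex_on_def m_def by auto
    then have gm: "g m \<le> ereal ((1 - t) * a + t * c)" by (simp add: a c)
    have "M m = M u + t *\<^sub>R s"
      unfolding s_def m_def using M by (simp add: linear_diff linear_add linear_scale algebra_simps)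
    then have Mm: "M m + d = (M u + d) + t *\<^sub>R s"
      by simp
    have "g u + ereal (penalty \<rho> y (M u + d)) \<le> ereal ((1 - t) * a + t * c) + ereal (penalty \<rho> y (M m + d))"
      using min_u[OF m] add_right_mono[OF gm] order_trans by blast
    then have "a + penalty \<rho> y (M u + d) \<le> (1 - t) * a + t * c + penalty \<rho> y (M m + d)"
      by (simp add: a)
    then have "t * (a - c) \<le> t * (p + t * q)"
      unfolding Mm penalty_line p_def[symmetric] q_def[symmetric]
      by (simp add: algebra_simps power2_eq_square)
    then show ?thesis using t by simp
  qed
  have "((\<lambda>t. p + t * q) \<longlongrightarrow> p + 0 * q) (at_right 0)"
    by (intro tendsto_intros)
  moreover have "\<forall>\<^sub>F t in at_right 0. a - c \<le> p + t * q"
    by (intro eventually_at_rightI[of 0 1]) (auto intro: le)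
  ultimately have "a - c \<le> p"
    using tendsto_lowerbound by fastforce
  then show ?thesis by (simp add: a c s_def[symmetric] p_def[symmetric])
qed simp

text \<open>
  The subgradient that comes from minimality at \<open>u\<close> is orthogonal to \<open>w - u\<close>, because \<open>A\<close> maps
  \<open>w - u\<close> to zero.  The strong convexity inequality for it reads
  \<open>g u + D/2 \<parallel>w - u\<parallel>\<^sup>2 \<le> g w\<close>, while \<open>g w \<le> g u\<close>.
\<close>

lemma strongly_convex_minimizer_unique:
  fixes g :: "real^'p \<Rightarrow> ereal" and A :: "real^'p^'q"
  assumes g: "strongly_convex_on (block_space b i) g" and fin: "\<And>v. g v \<noteq> -\<infinity>" "g u < \<infinity>" "g w < \<infinity>"
    and uw: "u \<in> block_space b i" "w \<in> block_space b i"
    and min_u: "\<And>v. v \<in> block_space b i \<Longrightarrow> 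
        g u + ereal (penalty \<rho> y (A *v u + d)) \<le> g v + ereal (penalty \<rho> y (A *v v + d))"
    and min_w: "g w + ereal (penalty \<rho> y (A *v w + d)) \<le> g u + ereal (penalty \<rho> y (A *v u + d))"
    and same: "A *v (w - u) = 0"
  shows "w = u"
proof -
  let ?S = "block_space b i"
  \<comment> \<open>Subgradients are required to lie in the block, so the negative gradient of the penalty is
      projected; this does not change its inner products with vectors of the block.\<close>
  define v where "v = - block b i ((y + \<rho> *\<^sub>R (A *v u + d)) v* A)"
  have v: "v \<bullet> s = - ((y + \<rho> *\<^sub>R (A *v u + d)) \<bullet> (A *v s))" if "s \<in> ?S" for s
    using that by (simp add: v_def inner_block dot_lmul_matrix)
  have sub: "w' - u \<in> ?S" if "w' \<in> ?S" for w'
    using that uw subspace_block_space by (intro subspace_diff) auto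
  have conv: "ereal_convex_on ?S g" using g by (simp add: strongly_convex_on_def)
  have "v \<in> ?S"
    unfolding v_def by (intro subspace_neg subspace_block_space) simp
  moreover have "g u + ereal (v \<bullet> (w' - u)) \<le> g w'" if "w' \<in> ?S" for w'
    using minimizer_subgradient[OF conv _ fin(1,2) matrix_vector_mul_linear uw(1) min_u that]
    by (simp add: v sub that subspace_block_space subspace_imp_convex)
  ultimately have "v \<in> subdifferential_on ?S g u"
    by (simp add: subdifferential_on_def)
  then obtain D where D: "D > 0"
    "g u + ereal (v \<bullet> (w - u)) + ereal (D / 2 * (norm (w - u))\<^sup>2) \<le> g w"
    using g fin uw unfolding strongly_convex_on_def by blast
  have "v \<bullet> (w - u) = 0" using v[OF sub[OF uw(2)]] by (simp add: same)
  moreover have "A *v w = A *v u" using same by (simp add: matrix_vector_mult_diff_distrib)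
  moreover obtain a where "g u = ereal a" using fin by (cases "g u") auto
  moreover obtain c where "g w = ereal c" using fin by (cases "g w") auto
  ultimately have "D * (norm (w - u))\<^sup>2 \<le> 0"
    using D min_w by simp
  then show ?thesis using D(1) by (simp add: mult_le_0_iff)
qed

section \<open>The augmented Lagrangian\<close>

text \<open>
  Everything in the augmented Lagrangian except \<open>f\<close>, the only term that can be infinite.
\<close>

definition smooth_part ::
    "real^'p^'q \<Rightarrow> (real^'q \<Rightarrow> real) \<Rightarrow> real \<Rightarrow> real^'p \<Rightarrow> real^'q \<Rightarrow> real^'q \<Rightarrow> real" where
  "smooth_part A h \<rho> x z y = h z + penalty \<rho> y (A *v x - z)"

lemma aug_lagrangian_eq:
  assumes "range b \<subseteq> {1..n}"
  shows "aug_lagrangian b n A f h \<rho> x z y = f x + ereal (smooth_part A h \<rho> x z y)"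
  unfolding aug_lagrangian_def objective_def smooth_part_def penalty_def residual_eq[OF assms]
  by (simp add: add.assoc)

lemma tendsto_aug_lagrangian:
  assumes "range b \<subseteq> {1..n}" "continuous_on UNIV f" "continuous_on UNIV h"
    and X: "(X \<longlongrightarrow> x) F" and Z: "(Z \<longlongrightarrow> z) F" and Y: "(Y \<longlongrightarrow> y) F"
  shows "((\<lambda>k. aug_lagrangian b n A f h \<rho> (X k) (Z k) (Y k)) 
            \<longlongrightarrow> aug_lagrangian b n A f h \<rho> x z y) F"
proof -
  have "((\<lambda>k. f (X k)) \<longlongrightarrow> f x) F" "((\<lambda>k. h (Z k)) \<longlongrightarrow> h z) F"
    by (auto intro: continuous_on_tendsto_compose[OF assms(2) X] continuous_on_tendsto_compose[OF assms(3) Z])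
  moreover from this(2) have 
    "((\<lambda>k. smooth_part A h \<rho> (X k) (Z k) (Y k)) \<longlongrightarrow> smooth_part A h \<rho> x z y) F"
    unfolding smooth_part_def penalty_def
    by (intro tendsto_intros X Z Y
        bounded_linear.tendsto[OF matrix_vector_mul_bounded_linear])
  ultimately show ?thesis
    unfolding aug_lagrangian_eq[OF assms(1)] by (intro tendsto_add_ereal_general1) auto
qed

text \<open>
  The tangent inequality for functions of one real variable, applied on the line through \<open>c\<close>
  and \<open>w\<close>.
\<close>

lemma convex_gradient_inequality:
  fixes h :: "'a::real_inner \<Rightarrow> real"
  assumes h: "convex_on UNIV h" and g: "GDERIV h c :> g"
  shows "h c + g \<bullet> (w - c) \<le> h w"
proof -
  define \<phi> where "\<phi> t = h (c + t *\<^sub>R (w - c))" for t :: real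
  have "convex_on UNIV \<phi>"
  proof (rule convex_onI)
    fix t u v :: real assume "0 < t" "t < 1"
    moreover have "c + ((1 - t) *\<^sub>R u + t *\<^sub>R v) *\<^sub>R (w - c)
        = (1 - t) *\<^sub>R (c + u *\<^sub>R (w - c)) + t *\<^sub>R (c + v *\<^sub>R (w - c))"
      by (simp add: algebra_simps)
    ultimately show "\<phi> ((1 - t) *\<^sub>R u + t *\<^sub>R v) \<le> (1 - t) * \<phi> u + t * \<phi> v"
      unfolding \<phi>_def by (simp only: convex_onD[OF h] UNIV_I less_imp_le)
  qed simp
  moreover have "(\<phi> has_field_derivative (g \<bullet> (w - c))) (at 0)"
  proof -
    have "((\<lambda>t. c + t *\<^sub>R (w - c)) has_derivative (\<lambda>t. t *\<^sub>R (w - c))) (at 0)"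
      by (auto intro!: derivative_eq_intros)
    moreover have "(h has_derivative (\<lambda>v. v \<bullet> g)) (at (c + 0 *\<^sub>R (w - c)))"
      using g by (simp add: gderiv_def)
    ultimately show ?thesis
      unfolding has_field_derivative_def \<phi>_def
      by (rule has_derivative_compose[THEN has_derivative_eq_rhs])
         (simp add: fun_eq_iff inner_commute mult.commute)
  qed
  ultimately have "\<phi> 1 - \<phi> 0 \<ge> (g \<bullet> (w - c)) * (1 - 0)"
    by (intro convex_on_imp_above_tangent[where A = UNIV]) auto
  then show ?thesis by (simp add: \<phi>_def)
qed

text \<open>
  The right-hand side is the new dual variable, so this condition identifies the dual iterates
  with gradients of \<open>h\<close>.
\<close>

lemma z_minimizer_gradient:
  fixes A :: "real^'p^'q"
  assumes g: "GDERIV h z' :> g"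
    and min: "\<And>w. smooth_part A h \<rho> x z' y \<le> smooth_part A h \<rho> x w y"
  shows "g = y + \<rho> *\<^sub>R (A *v x - z')"
proof -
  let ?r = "A *v x - z'"
  have "((\<lambda>w. smooth_part A h \<rho> x w y) has_derivative
      (\<lambda>v. v \<bullet> g + (y \<bullet> (- v) + \<rho> * (?r \<bullet> (- v))))) (at z')"
    using g unfolding gderiv_def smooth_part_def penalty_def power2_norm_eq_inner
    by (auto intro!: derivative_eq_intros simp: inner_commute)
  then have zero: "(\<lambda>v. v \<bullet> g + (y \<bullet> (- v) + \<rho> * (?r \<bullet> (- v)))) = (\<lambda>v. 0)"
    by (rule differential_zero_maxmin[OF UNIV_I open_UNIV]) (use min in auto)
  have "v \<bullet> (g - (y + \<rho> *\<^sub>R ?r)) = 0" for v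
    using fun_cong[OF zero, of v]
    by (simp add: inner_diff_right inner_add_right inner_commute algebra_simps)
  from this[of "g - (y + \<rho> *\<^sub>R ?r)"] show ?thesis by simp
qed

text \<open>
  The first-order terms of \<open>h\<close> and of the penalty cancel at \<open>z'\<close>.  By convexity \<open>h\<close> lies above
  its tangent, so the quadratic term of the penalty remains as the gain.
\<close>

lemma z_step_decrease:
  fixes A :: "real^'p^'q"
  assumes h: "convex_on UNIV h" and g: "GDERIV h z' :> y + \<rho> *\<^sub>R (A *v x - z')"
  shows "smooth_part A h \<rho> x z' y + \<rho> / 2 * (norm (z' - z))\<^sup>2 \<le> smooth_part A h \<rho> x z y"
proof -
  have r: "A *v x - z = (A *v x - z') + 1 *\<^sub>R (z' - z)" by simp
  have "h z' + (y + \<rho> *\<^sub>R (A *v x - z')) \<bullet> (z - z') \<le> h z"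
    by (rule convex_gradient_inequality[OF h g])
  then show ?thesis
    unfolding smooth_part_def r penalty_line by (simp add: inner_diff_right)
qed

lemma minimizer_onD:
  assumes "minimizer_on S g u"
  shows "u \<in> S" "g u < \<infinity>" "\<And>v. v \<in> S \<Longrightarrow> g u \<le> g v"
  using assms by (auto simp: minimizer_on_def is_arg_min_def not_less)

section \<open>Descent along the iteration\<close>

lemma admm_block_step:
  assumes admm: "admm_sequence b n A f h \<rho> x z y" and i: "i \<in> {1..n}" and u: "u \<in> block_space b i"
  shows "aug_lagrangian b n A f h \<rho> (sweep_point b (Suc i) (x (Suc k)) (x k)) (z k) (y k)
    \<le> aug_lagrangian b n A f h \<rho> (put_block b i (sweep_point b i (x (Suc k)) (x k)) u) (z k) (y k)"
proof -
  have "minimizer_on (block_space b i)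
            (\<lambda>u. aug_lagrangian b n A f h \<rho>
                   (put_block b i (sweep_point b i (x (Suc k)) (x k)) u) (z k) (y k))
            (block b i (x (Suc k)))"
    using admm i by (simp add: admm_sequence_def)
  from minimizer_onD(3)[OF this u] show ?thesis
    by (simp add: put_block_sweep_point)
qed

text \<open>
  The old value of a block is one of the competitors in its update.
\<close>

lemma admm_sweep_decrease:
  assumes admm: "admm_sequence b n A f h \<rho> x z y" and "1 \<le> i" "i \<le> j" "j \<le> Suc n"
  shows "aug_lagrangian b n A f h \<rho> (sweep_point b j (x (Suc k)) (x k)) (z k) (y k)
    \<le> aug_lagrangian b n A f h \<rho> (sweep_point b i (x (Suc k)) (x k)) (z k) (y k)"
  using \<open>i \<le> j\<close> \<open>j \<le> Suc n\<close>
proof (induction j rule: dec_induct)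
  case (step j)
  let ?s = "sweep_point b j (x (Suc k)) (x k)"
  have "aug_lagrangian b n A f h \<rho> (sweep_point b (Suc j) (x (Suc k)) (x k)) (z k) (y k)
    \<le> aug_lagrangian b n A f h \<rho> (put_block b j ?s (block b j ?s)) (z k) (y k)"
    using step \<open>1 \<le> i\<close> by (intro admm_block_step[OF admm]) auto
  also have "\<dots> \<le> aug_lagrangian b n A f h \<rho> (sweep_point b i (x (Suc k)) (x k)) (z k) (y k)"
    using step by simp
  finally show ?case .
qed simp

text \<open>
  The values inside the \<open>k\<close>-th sweep lie between the values of the Lagrangian at two consecutive
  iterates, so they share the limit of the latter.  The identity \<open>y\<^bsup>k\<^esup> = \<nabla>h(z\<^bsup>k\<^esup>)\<close> may fail for
  the arbitrary start \<open>k = 0\<close>, so the descent begins at the first iterate.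
\<close>

lemma admm_lagrangian_limit:
  fixes A :: "real^'p^'q"
  assumes blocks: "range b \<subseteq> {1..n}"
    and f_proper: "proper f" and f_cont: "continuous_on UNIV f"
    and h_convex: "convex_on UNIV h"
    and h_gradient: "\<And>w. GDERIV h w :> grad_h w"
    and h_lipschitz: "lipschitz_on H UNIV grad_h"
    and rho: "\<rho> > 2 * H"
    and admm: "admm_sequence b n A f h \<rho> x z y"
    and bdd: "bounded (range (\<lambda>k. (x k, z k)))"
  obtains l :: real where
    "\<And>i. i \<in> {1..Suc n} \<Longrightarrow>
      (\<lambda>k. aug_lagrangian b n A f h \<rho> (sweep_point b i (x (Suc k)) (x k)) (z k) (y k)) \<longlonglongrightarrow> ereal l"
    and "(\<lambda>k. z (Suc k) - z k) \<longlonglongrightarrow> 0"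
    and "(\<lambda>k. A *v x k - z k) \<longlonglongrightarrow> 0"
    and "\<And>k. y (Suc k) = grad_h (z (Suc k))"
proof -
  let ?L = "aug_lagrangian b n A f h \<rho>"
  define r where "r k = A *v x k - z k" for k
  have H: "H \<ge> 0" using h_lipschitz by (rule lipschitz_on_nonneg)
  then have \<rho>: "\<rho> > 0" using rho by simp
  note L_eq = aug_lagrangian_eq[OF blocks, of A f h \<rho>]
  have h_cont: "continuous_on UNIV h"
    using h_gradient unfolding gderiv_def by (meson continuous_at_imp_continuous_on has_derivative_continuous)
  have grad_cont: "continuous_on UNIV grad_h"
    using h_lipschitz by (rule lipschitz_on_continuous_on)
  have f_bot: "f w \<noteq> -\<infinity>" for w using f_proper by (simp add: proper_def)
  have y_step: "y (Suc k) = y k + \<rho> *\<^sub>R r (Suc k)" for k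
    using admm by (simp add: admm_sequence_def residual_eq[OF blocks] r_def)
  have z_min: "minimizer_on UNIV (\<lambda>w. ?L (x (Suc k)) w (y k)) (z (Suc k))" for k
    using admm by (simp add: admm_sequence_def)
  have f_fin: "\<exists>a. f (x (Suc k)) = ereal a" for k
    using minimizer_onD(2)[OF z_min[of k]] f_bot[of "x (Suc k)"] unfolding L_eq
    by (cases "f (x (Suc k))") auto
  have z_smooth_min: "smooth_part A h \<rho> (x (Suc k)) (z (Suc k)) (y k) \<le> smooth_part A h \<rho> (x (Suc k)) w (y k)" for k w
    using minimizer_onD(3)[OF z_min[of k], of w] f_fin[of k] unfolding L_eq by auto
  have y_grad: "y (Suc k) = grad_h (z (Suc k))" for k
    using z_minimizer_gradient[OF h_gradient z_smooth_min] y_step[of k] by (simp add: r_def)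

  define \<Lambda> where "\<Lambda> k = real_of_ereal (f (x (Suc k))) + smooth_part A h \<rho> (x (Suc k)) (z (Suc k)) (y (Suc k))" for k
  have \<Lambda>: "?L (x (Suc k)) (z (Suc k)) (y (Suc k)) = ereal (\<Lambda> k)" for k
    using f_fin[of k] by (auto simp: L_eq \<Lambda>_def)
  \<comment> \<open>Per step, the \<open>z\<close>-update gains \<open>\<rho>/2\<close> and the dual update loses at most \<open>H\<^sup>2/\<rho>\<close> times
      \<open>\<parallel>z\<^bsup>k+1\<^esup> - z\<^bsup>k\<^esup>\<parallel>\<^sup>2\<close>.\<close>
  define c where "c = \<rho> / 2 - H\<^sup>2 / \<rho>"
  have "H\<^sup>2 \<le> (\<rho> / 2)\<^sup>2" using H rho by (intro power_mono) auto
  then have "H\<^sup>2 / \<rho> \<le> \<rho> / 4" using \<rho> by (simp add: field_simps power2_eq_square)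
  then have c: "c > 0" using \<rho> unfolding c_def by linarith
  have r_bound: "\<rho> * norm (r (Suc (Suc k))) \<le> H * norm (z (Suc (Suc k)) - z (Suc k))" for k
  proof -
    have "\<rho> *\<^sub>R r (Suc (Suc k)) = grad_h (z (Suc (Suc k))) - grad_h (z (Suc k))"
      using y_step[of "Suc k"] y_grad by simp
    then have "\<rho> * norm (r (Suc (Suc k))) = dist (grad_h (z (Suc (Suc k)))) (grad_h (z (Suc k)))"
      using \<rho> by (metis abs_of_pos dist_norm norm_scaleR)
    also have "\<dots> \<le> H * dist (z (Suc (Suc k))) (z (Suc k))"
      using h_lipschitz by (rule lipschitz_onD) auto
    finally show ?thesis by (simp add: dist_norm)
  qed
  have descent: "ereal (\<Lambda> (Suc k) + c * (norm (z (Suc (Suc k)) - z (Suc k)))\<^sup>2)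
      \<le> ?L (x (Suc (Suc k))) (z (Suc k)) (y (Suc k))" for k
  proof -
    let ?x = "x (Suc (Suc k))" and ?z = "z (Suc (Suc k))" and ?d = "norm (z (Suc (Suc k)) - z (Suc k))"
    have "smooth_part A h \<rho> ?x ?z (y (Suc k)) + \<rho> / 2 * ?d\<^sup>2 \<le> smooth_part A h \<rho> ?x (z (Suc k)) (y (Suc k))"
      using h_gradient[of ?z] y_grad[of "Suc k"] y_step[of "Suc k"]
      by (intro z_step_decrease[OF h_convex]) (simp add: r_def)
    moreover have "smooth_part A h \<rho> ?x ?z (y (Suc (Suc k)))
        = smooth_part A h \<rho> ?x ?z (y (Suc k)) + \<rho> * (norm (r (Suc (Suc k))))\<^sup>2"
      unfolding y_step[of "Suc k"] smooth_part_def penalty_def r_def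
      by (simp add: inner_add_left power2_norm_eq_inner)
    moreover have "\<rho> * (norm (r (Suc (Suc k))))\<^sup>2 \<le> H\<^sup>2 / \<rho> * ?d\<^sup>2"
    proof -
      have "(\<rho> * norm (r (Suc (Suc k))))\<^sup>2 \<le> (H * ?d)\<^sup>2"
        using r_bound \<rho> by (intro power_mono) auto
      then show ?thesis using \<rho> by (simp add: field_simps power2_eq_square)
    qed
    ultimately show ?thesis
      using f_fin[of "Suc k"] by (auto simp: L_eq \<Lambda>_def c_def algebra_simps)
  qed
  have sweep_le: "?L (sweep_point b i (x (Suc (Suc k))) (x (Suc k))) (z (Suc k)) (y (Suc k)) \<le> ereal (\<Lambda> k)"
    and sweep_ge: "ereal (\<Lambda> (Suc k) + c * (norm (z (Suc (Suc k)) - z (Suc k)))\<^sup>2)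
      \<le> ?L (sweep_point b i (x (Suc (Suc k))) (x (Suc k))) (z (Suc k)) (y (Suc k))"
    if "i \<in> {1..Suc n}" for i k
  proof -
    show "?L (sweep_point b i (x (Suc (Suc k))) (x (Suc k))) (z (Suc k)) (y (Suc k)) \<le> ereal (\<Lambda> k)"
      using admm_sweep_decrease[OF admm, of 1 i "Suc k"] that
      unfolding sweep_point_first[OF blocks] \<Lambda> by auto
    show "ereal (\<Lambda> (Suc k) + c * (norm (z (Suc (Suc k)) - z (Suc k)))\<^sup>2)
      \<le> ?L (sweep_point b i (x (Suc (Suc k))) (x (Suc k))) (z (Suc k)) (y (Suc k))"
      using order_trans[OF descent admm_sweep_decrease[OF admm, of i "Suc n" "Suc k", unfolded sweep_point_last[OF blocks]]]
        that by auto
  qed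
  have \<Lambda>_step: "\<Lambda> (Suc k) + c * (norm (z (Suc (Suc k)) - z (Suc k)))\<^sup>2 \<le> \<Lambda> k" for k
    using order_trans[OF sweep_ge[of 1 k] sweep_le[of 1 k]] by simp
  have dec: "decseq \<Lambda>"
    using \<Lambda>_step c by (intro decseq_SucI) (smt (verit) mult_nonneg_nonneg zero_le_power2)

  \<comment> \<open>Since \<open>y\<^bsup>k\<^esup> = \<nabla>h(z\<^bsup>k\<^esup>)\<close>, the value at an iterate is a continuous function of \<open>(x\<^bsup>k\<^esup>, z\<^bsup>k\<^esup>)\<close> alone,
      and it attains its infimum on the closure of the bounded orbit; there \<open>f > -\<infinity>\<close>.\<close>
  obtain m where m: "\<And>k. m \<le> \<Lambda> k"
  proof -
    let ?K = "closure (range (\<lambda>k. (x k, z k)))"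
    let ?\<phi> = "\<lambda>p. ?L (fst p) (snd p) (grad_h (snd p))"
    have "continuous_on ?K ?\<phi>"
      unfolding continuous_on_def
      by (intro ballI tendsto_aug_lagrangian[OF blocks f_cont h_cont]
          tendsto_intros continuous_on_tendsto_compose[OF grad_cont]) auto
    moreover have "compact ?K" using bdd by (rule compact_closure[THEN iffD2])
    moreover have "?K \<noteq> {}" by simp
    ultimately obtain p where p: "\<And>p'. p' \<in> ?K \<Longrightarrow> ?\<phi> p \<le> ?\<phi> p'"
      using continuous_attains_inf[of ?K ?\<phi>] by blast
    have le: "?\<phi> p \<le> ereal (\<Lambda> k)" for k
    proof -
      have "(x (Suc k), z (Suc k)) \<in> ?K" by (intro closure_subset[THEN subsetD] rangeI)
      from p[OF this] show ?thesis by (simp add: \<Lambda> flip: y_grad)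
    qed
    have "?\<phi> p \<noteq> -\<infinity>" using f_bot by (simp add: L_eq)
    then obtain m where "?\<phi> p = ereal m" using le[of 0] by (cases "?\<phi> p") auto
    then show thesis using le that[of m] by simp
  qed
  obtain l where l: "\<Lambda> \<longlonglongrightarrow> l"
    using decseq_convergent[OF dec, of m] m by blast
  have \<Lambda>_diff: "(\<lambda>k. \<Lambda> k - \<Lambda> (Suc k)) \<longlonglongrightarrow> 0"
    using tendsto_diff[OF l LIMSEQ_Suc[OF l]] by simp
  have "(\<lambda>k. (norm (z (Suc (Suc k)) - z (Suc k)))\<^sup>2) \<longlonglongrightarrow> 0"
  proof (rule tendsto_sandwich[OF _ _ tendsto_const])
    show "(\<lambda>k. (\<Lambda> k - \<Lambda> (Suc k)) / c) \<longlonglongrightarrow> 0"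
      using tendsto_divide[OF \<Lambda>_diff tendsto_const[of c]] c by simp
    show "\<forall>\<^sub>F k in sequentially. (norm (z (Suc (Suc k)) - z (Suc k)))\<^sup>2 \<le> (\<Lambda> k - \<Lambda> (Suc k)) / c"
    proof (intro always_eventually allI)
      fix k
      show "(norm (z (Suc (Suc k)) - z (Suc k)))\<^sup>2 \<le> (\<Lambda> k - \<Lambda> (Suc k)) / c"
        using \<Lambda>_step[of k] c by (simp add: pos_le_divide_eq mult.commute)
    qed
  qed simp
  then have "(\<lambda>k. sqrt ((norm (z (Suc (Suc k)) - z (Suc k)))\<^sup>2)) \<longlonglongrightarrow> sqrt 0"
    by (rule tendsto_real_sqrt)
  then have dz: "(\<lambda>k. norm (z (Suc (Suc k)) - z (Suc k))) \<longlonglongrightarrow> 0" by simp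
  have "(\<lambda>k. norm (r (Suc (Suc k)))) \<longlonglongrightarrow> 0"
  proof (rule tendsto_sandwich[OF _ _ tendsto_const])
    show "(\<lambda>k. H / \<rho> * norm (z (Suc (Suc k)) - z (Suc k))) \<longlonglongrightarrow> 0"
      using tendsto_mult[OF tendsto_const dz, of "H / \<rho>"] by simp
    show "\<forall>\<^sub>F k in sequentially. norm (r (Suc (Suc k))) \<le> H / \<rho> * norm (z (Suc (Suc k)) - z (Suc k))"
      using r_bound \<rho> by (intro always_eventually allI) (simp add: field_simps)
  qed simp
  then have dr: "(\<lambda>k. r (Suc (Suc k))) \<longlonglongrightarrow> 0" by (rule tendsto_norm_zero_cancel)
  show thesis
  proof (rule that)
    fix i assume i: "i \<in> {1..Suc n}"
    have "ereal (\<Lambda> (Suc k)) \<le> ?L (sweep_point b i (x (Suc (Suc k))) (x (Suc k))) (z (Suc k)) (y (Suc k))" for k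
      using c by (intro order_trans[OF _ sweep_ge[OF i]]) simp
    then have "(\<lambda>k. ?L (sweep_point b i (x (Suc (Suc k))) (x (Suc k))) (z (Suc k)) (y (Suc k)))
        \<longlonglongrightarrow> ereal l"
      using sweep_le[OF i]
      by (intro tendsto_sandwich[OF always_eventually always_eventually
            tendsto_ereal[OF LIMSEQ_Suc[OF l]] tendsto_ereal[OF l]] allI)
    then show "(\<lambda>k. ?L (sweep_point b i (x (Suc k)) (x k)) (z k) (y k)) \<longlonglongrightarrow> ereal l"
      by (rule LIMSEQ_imp_Suc[where f = "\<lambda>k. ?L (sweep_point b i (x (Suc k)) (x k)) (z k) (y k)"])
  next
    show "(\<lambda>k. z (Suc k) - z k) \<longlonglongrightarrow> 0"
      by (rule LIMSEQ_imp_Suc[of "\<lambda>k. z (Suc k) - z k"], rule tendsto_norm_zero_cancel) (rule dz)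
    have "r \<longlonglongrightarrow> 0"
      by (rule LIMSEQ_imp_Suc, rule LIMSEQ_imp_Suc) (rule dr)
    then show "(\<lambda>k. A *v x k - z k) \<longlonglongrightarrow> 0"
      by (simp add: r_def[abs_def])
  qed (rule y_grad)
qed


section \<open>Limit points\<close>

text \<open>
  Two minimizers have the same image under \<open>A\<close>.  If \<open>A\<^sub>i\<close> has full rank, this already makes
  them equal; otherwise strong convexity separates points with the same image.
\<close>

lemma aug_lagrangian_block_minimizer_unique:
  fixes A :: "real^'p^'q"
  assumes blocks: "range b \<subseteq> {1..n}" and i: "i \<in> {1..n}" and \<rho>: "\<rho> > 0"
    and f_bot: "\<And>v. f v \<noteq> -\<infinity>" and f_multi_convex: "multi_convex b n f"
    and rank_or_strong: "rank (block_matrix b i A) = card {j. b j = i} \<or>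
      strongly_convex_on (block_space b i) (\<lambda>u. objective f h (put_block b i x u) z)"
    and minimizers: "u\<^sub>1 \<in> block_space b i" "u\<^sub>2 \<in> block_space b i"
    and fin: "f (put_block b i x u\<^sub>1) < \<infinity>" "f (put_block b i x u\<^sub>2) < \<infinity>"
    and min\<^sub>1: "\<And>u. u \<in> block_space b i \<Longrightarrow>
      aug_lagrangian b n A f h \<rho> (put_block b i x u\<^sub>1) z y \<le> aug_lagrangian b n A f h \<rho> (put_block b i x u) z y"
    and min\<^sub>2: "\<And>u. u \<in> block_space b i \<Longrightarrow>
      aug_lagrangian b n A f h \<rho> (put_block b i x u\<^sub>2) z y \<le> aug_lagrangian b n A f h \<rho> (put_block b i x u) z y"
  shows "u\<^sub>2 = u\<^sub>1"
proof -
  let ?S = "block_space b i"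
  define d where "d = A *v (x - block b i x) - z"
  define g where "g u = f (put_block b i x u)" for u
  define g' where "g' u = objective f h (put_block b i x u) z" for u
  have L: "aug_lagrangian b n A f h \<rho> (put_block b i x u) z y = g u + ereal (h z + penalty \<rho> y (A *v u + d))"
    if "u \<in> ?S" for u
    using that unfolding aug_lagrangian_eq[OF blocks] smooth_part_def
    by (simp add: put_block_eq d_def g_def algebra_simps matrix_vector_right_distrib matrix_vector_mult_diff_distrib)
  have min_g: "g v + ereal (penalty \<rho> y (A *v v + d)) \<le> g u + ereal (penalty \<rho> y (A *v u + d))"
    and min_g': "g' v + ereal (penalty \<rho> y (A *v v + d)) \<le> g' u + ereal (penalty \<rho> y (A *v u + d))"
    if "v \<in> {u\<^sub>1, u\<^sub>2}" "u \<in> ?S" for u v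
  proof -
    have le: "g v + ereal (h z + penalty \<rho> y (A *v v + d)) \<le> g u + ereal (h z + penalty \<rho> y (A *v u + d))"
      using min\<^sub>1[OF that(2)] min\<^sub>2[OF that(2)] that minimizers by (auto simp: L)
    then show "g v + ereal (penalty \<rho> y (A *v v + d)) \<le> g u + ereal (penalty \<rho> y (A *v u + d))"
      by (cases "g v"; cases "g u") auto
    show "g' v + ereal (penalty \<rho> y (A *v v + d)) \<le> g' u + ereal (penalty \<rho> y (A *v u + d))"
      using le by (simp add: g'_def g_def objective_def add.assoc)
  qed
  have "ereal_convex_on ?S g"
    using f_multi_convex i unfolding multi_convex_def g_def by blast
  then have same: "A *v (u\<^sub>2 - u\<^sub>1) = 0"
    using f_bot fin \<rho> minimizers min_g subspace_imp_convex[OF subspace_block_space]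
    by (intro minimizers_have_same_image[where M = "(*v) A" and g = g and S = ?S and d = d and y = y and \<rho> = \<rho>])
       (auto simp: g_def)
  from rank_or_strong show ?thesis
  proof
    assume "rank (block_matrix b i A) = card {j. b j = i}"
    moreover have "u\<^sub>2 - u\<^sub>1 \<in> ?S" by (intro subspace_diff subspace_block_space minimizers)
    ultimately show ?thesis using full_rank_block_kernel[OF _ _ same] by simp
  next
    assume "strongly_convex_on ?S (\<lambda>u. objective f h (put_block b i x u) z)"
    then have "strongly_convex_on ?S g'" by (simp add: g'_def[abs_def])
    moreover have "g' v \<noteq> -\<infinity>" "g' u\<^sub>1 < \<infinity>" "g' u\<^sub>2 < \<infinity>" for v
      using f_bot fin by (auto simp: g'_def objective_def)
    ultimately show ?thesis
      using minimizers min_g' same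
      by (intro strongly_convex_minimizer_unique[where g = g' and b = b and i = i and d = d]) auto
  qed
qed

text \<open>
  Here \<open>xs\<close> and \<open>xs'\<close> are limits of the iterates and of their successors along one subsequence.
  The induction over the blocks shows that a sweep from \<open>xs\<close> to \<open>xs'\<close> never leaves \<open>xs\<close>: the
  Lagrangian is constant along the limit sweep, and a minimizing block can only be replaced by
  another minimizer, that is, by itself.
\<close>

lemma limit_point_block_minimizer:
  fixes A :: "real^'p^'q"
  assumes blocks: "range b \<subseteq> {1..n}"
    and f_bot: "\<And>v. f v \<noteq> -\<infinity>" and f_cont: "continuous_on UNIV f" and h_cont: "continuous_on UNIV h"
    and f_multi_convex: "multi_convex b n f" and \<rho>: "\<rho> > 0"
    and admm: "admm_sequence b n A f h \<rho> x z y"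
    and rank_or_strong: "\<And>i. i \<in> {1..n} \<Longrightarrow> rank (block_matrix b i A) = card {j. b j = i} \<or>
      strongly_convex_on (block_space b i) (\<lambda>u. objective f h (put_block b i xs u) zs)"
    and L_lim: "\<And>i. i \<in> {1..Suc n} \<Longrightarrow>
      (\<lambda>k. aug_lagrangian b n A f h \<rho> (sweep_point b i (x (Suc k)) (x k)) (z k) (y k)) \<longlonglongrightarrow> ereal l"
    and s: "strict_mono s"
    and x_lim: "(\<lambda>k. x (s k)) \<longlonglongrightarrow> xs" and x'_lim: "(\<lambda>k. x (Suc (s k))) \<longlonglongrightarrow> xs'"
    and z_lim: "(\<lambda>k. z (s k)) \<longlonglongrightarrow> zs" and y_lim: "(\<lambda>k. y (s k)) \<longlonglongrightarrow> ys"
    and i: "i \<in> {1..n}" and u: "u \<in> block_space b i"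
  shows "aug_lagrangian b n A f h \<rho> xs zs ys \<le> aug_lagrangian b n A f h \<rho> (put_block b i xs u) zs ys"
proof -
  let ?L = "aug_lagrangian b n A f h \<rho>"
  let ?p = "\<lambda>i k. sweep_point b i (x (Suc k)) (x k)"
  have L_tendsto: "(\<lambda>k. ?L (X k) (z (s k)) (y (s k))) \<longlonglongrightarrow> ?L w zs ys" if "X \<longlonglongrightarrow> w" for X w
    by (rule tendsto_aug_lagrangian[OF blocks f_cont h_cont that z_lim y_lim])
  have sweep_lim: "(\<lambda>k. ?p i (s k)) \<longlonglongrightarrow> sweep_point b i xs' xs" for i
    by (rule tendsto_sweep_point[OF x'_lim x_lim])
  have L_sweep: "?L (sweep_point b i xs' xs) zs ys = ereal l" if "i \<in> {1..Suc n}" for i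
    using LIMSEQ_subseq_LIMSEQ[OF L_lim[OF that] s] L_tendsto[OF sweep_lim]
    by (auto simp: o_def intro: LIMSEQ_unique)
  have L_xs: "?L xs zs ys = ereal l"
    using L_sweep[of 1] unfolding sweep_point_first[OF blocks] by simp
  have f_fin: "f w < \<infinity>" if "?L w zs ys = ereal l" for w
    using that unfolding aug_lagrangian_eq[OF blocks] by (cases "f w") auto
  have block_min: "ereal l \<le> ?L (put_block b i xs u) zs ys"
    if fixed: "sweep_point b i xs' xs = xs" and i: "i \<in> {1..n}" and u: "u \<in> block_space b i" for i u
  proof (rule LIMSEQ_le)
    show "(\<lambda>k. ?L (?p (Suc i) (s k)) (z (s k)) (y (s k))) \<longlonglongrightarrow> ereal l"
      using L_tendsto[OF sweep_lim[of "Suc i"]] L_sweep[of "Suc i"] i by simp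
    show "(\<lambda>k. ?L (put_block b i (?p i (s k)) u) (z (s k)) (y (s k))) \<longlonglongrightarrow> ?L (put_block b i xs u) zs ys"
      using L_tendsto[OF tendsto_put_block[OF sweep_lim[of i]]] by (simp add: fixed)
  qed (use admm_block_step[OF admm i u] in blast)
  have fixed: "sweep_point b i xs' xs = xs" if "1 \<le> i" "i \<le> Suc n" for i
    using that
  proof (induction i rule: dec_induct)
    case base
    show ?case by (rule sweep_point_first[OF blocks])
  next
    case (step j)
    then have j: "j \<in> {1..n}" and fixed_j: "sweep_point b j xs' xs = xs" by auto
    have sweep_j: "put_block b j xs (block b j xs') = sweep_point b (Suc j) xs' xs"
      using put_block_sweep_point[of b j xs' xs] by (simp add: fixed_j)
    have L_j: "?L (put_block b j xs (block b j xs)) zs ys = ereal l"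
      "?L (put_block b j xs (block b j xs')) zs ys = ereal l"
      using L_xs L_sweep[of "Suc j"] j by (simp_all add: sweep_j)
    have "block b j xs' = block b j xs"
      by (rule aug_lagrangian_block_minimizer_unique[where y = ys, OF blocks j \<rho> f_bot f_multi_convex
            rank_or_strong[OF j] _ _ f_fin[OF L_j(1)] f_fin[OF L_j(2)]])
        (unfold L_j, use block_min[OF fixed_j j] in auto)
    then show ?case using sweep_j by simp
  qed
  show ?thesis
    using block_min[OF fixed i u] i by (simp add: L_xs)
qed

theorem theorem2:
  fixes b :: "'p::finite \<Rightarrow> nat"
    and n :: nat
    and A :: "real^'p^'q"
    and f :: "real^'p \<Rightarrow> ereal"
    and h :: "real^'q \<Rightarrow> real"
    and grad_h :: "real^'q \<Rightarrow> real^'q"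
    and H \<rho> :: real
    and x :: "nat \<Rightarrow> real^'p"
    and z y :: "nat \<Rightarrow> real^'q"
  assumes blocks: "range b \<subseteq> {1..n}"
    and f_proper: "proper f"
    and f_continuous: "continuous_on UNIV f"
    and f_multi_convex: "multi_convex b n f"
    and h_convex: "convex_on UNIV h"
    and h_gradient: "\<And>w. GDERIV h w :> grad_h w"
    and h_lipschitz: "lipschitz_on H UNIV grad_h"
    and bounded_below:
      "\<exists>m::real. \<forall>x' z'. feasible b n A x' z' \<longrightarrow> ereal m \<le> objective f h x' z'"
    and nash_exists: "\<exists>x' z'. nash_point b n A f h x' z'"
    and rho: "\<rho> > 2 * H"
    and admm: "admm_sequence b n A f h \<rho> x z y"
    and a_or_b:
      "(\<forall>i\<in>{1..n}. rank (block_matrix b i A) = card {j. b j = i}) \<or>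
       (\<forall>i\<in>{1..n}. \<forall>x' z'. strongly_convex_on (block_space b i)
          (\<lambda>u. objective f h (put_block b i x' u) z'))"
    and iterates_bounded: "bounded (range (\<lambda>k. (x k, z k)))"
  shows "(\<exists>l. seq_limit_point (\<lambda>k. (x k, z k)) l) \<and>
         (\<forall>xs zs. seq_limit_point (\<lambda>k. (x k, z k)) (xs, zs) \<longrightarrow>
            feasible b n A xs zs \<and> nash_point b n A f h xs zs)"
proof (intro conjI allI impI)
  show "\<exists>l. seq_limit_point (\<lambda>k. (x k, z k)) l"
    using bounded_imp_convergent_subsequence[OF iterates_bounded] by (simp add: seq_limit_point_def)
next
  fix xs zs assume "seq_limit_point (\<lambda>k. (x k, z k)) (xs, zs)"
  then obtain r where r: "strict_mono r" and r_lim: "(\<lambda>k. (x (r k), z (r k))) \<longlonglongrightarrow> (xs, zs)"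
    by (auto simp: seq_limit_point_def o_def)
  have f_bot: "f w \<noteq> -\<infinity>" for w using f_proper by (simp add: proper_def)
  have h_cont: "continuous_on UNIV h"
    using h_gradient unfolding gderiv_def by (meson continuous_at_imp_continuous_on has_derivative_continuous)
  have \<rho>: "\<rho> > 0" using rho lipschitz_on_nonneg[OF h_lipschitz] by simp
  obtain l where L_lim: "\<And>i. i \<in> {1..Suc n} \<Longrightarrow>
      (\<lambda>k. aug_lagrangian b n A f h \<rho> (sweep_point b i (x (Suc k)) (x k)) (z k) (y k)) \<longlonglongrightarrow> ereal l"
    and dz: "(\<lambda>k. z (Suc k) - z k) \<longlonglongrightarrow> 0"
    and res: "(\<lambda>k. A *v x k - z k) \<longlonglongrightarrow> 0"
    and y_grad: "\<And>k. y (Suc k) = grad_h (z (Suc k))"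
    by (rule admm_lagrangian_limit[OF blocks f_proper f_continuous h_convex h_gradient h_lipschitz
          rho admm iterates_bounded]) blast
  have "bounded (range (\<lambda>k. x (Suc (r k))))"
    by (rule bounded_subset[OF bounded_fst[OF iterates_bounded]]) (auto simp: image_image)
  then obtain xs' t where t: "strict_mono t" and t_lim: "(\<lambda>k. x (Suc (r (t k)))) \<longlonglongrightarrow> xs'"
    using bounded_imp_convergent_subsequence by (force simp: o_def)
  \<comment> \<open>The shift keeps the indices positive, as \<open>y\<^sup>0\<close> need not be a gradient of \<open>h\<close>.\<close>
  define s where "s = (\<lambda>k. r (t (Suc k)))"
  have s: "strict_mono s"
    using r t by (simp add: s_def strict_mono_def)
  have s_pos: "s k \<noteq> 0" for k
    using strict_mono_imp_increasing[OF s, of k] strict_monoD[OF r, of 0 "t (Suc k)"]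
      strict_monoD[OF t, of 0 "Suc k"] by (auto simp: s_def)
  have "(\<lambda>k. (x (s k), z (s k))) \<longlonglongrightarrow> (xs, zs)"
    using LIMSEQ_Suc[OF LIMSEQ_subseq_LIMSEQ[OF r_lim t]] by (simp add: o_def s_def)
  from tendsto_fst[OF this] tendsto_snd[OF this]
  have x_lim: "(\<lambda>k. x (s k)) \<longlonglongrightarrow> xs" and z_lim: "(\<lambda>k. z (s k)) \<longlonglongrightarrow> zs" by simp_all
  have x'_lim: "(\<lambda>k. x (Suc (s k))) \<longlonglongrightarrow> xs'"
    using LIMSEQ_Suc[OF t_lim] by (simp add: s_def)
  have "y (s k) = grad_h (z (s k))" for k
    using y_grad[of "s k - 1"] s_pos[of k] by simp
  then have y_lim: "(\<lambda>k. y (s k)) \<longlonglongrightarrow> grad_h zs"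
    using continuous_on_tendsto_compose[OF lipschitz_on_continuous_on[OF h_lipschitz] z_lim] by simp
  have "(\<lambda>k. A *v x (s k) - z (s k)) \<longlonglongrightarrow> A *v xs - zs"
    by (intro tendsto_intros z_lim bounded_linear.tendsto[OF matrix_vector_mul_bounded_linear x_lim])
  then have Axz: "A *v xs - zs = 0"
    using LIMSEQ_subseq_LIMSEQ[OF res s] unfolding o_def by (rule LIMSEQ_unique)
  then show feas: "feasible b n A xs zs"
    by (simp add: feasible_def residual_eq[OF blocks])
  show "nash_point b n A f h xs zs"
    unfolding nash_point_def
  proof (intro conjI ballI allI impI)
    fix i u assume iu: "i \<in> {1..n}" "u \<in> block_space b i" and feas_u: "feasible b n A (put_block b i xs u) zs"
    have "aug_lagrangian b n A f h \<rho> xs zs (grad_h zs)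
        \<le> aug_lagrangian b n A f h \<rho> (put_block b i xs u) zs (grad_h zs)"
      by (rule limit_point_block_minimizer[OF blocks f_bot f_continuous h_cont f_multi_convex \<rho> admm _ L_lim
            s x_lim x'_lim z_lim y_lim iu]) (use a_or_b in auto)
    then show "objective f h xs zs \<le> objective f h (put_block b i xs u) zs"
      using feas feas_u by (simp add: aug_lagrangian_def feasible_def)
  next
    fix z' assume "feasible b n A xs z'"
    then have "z' = zs" using Axz by (simp add: feasible_def residual_eq[OF blocks])
    then show "objective f h xs zs \<le> objective f h xs z'" by simp
  qed
qed

end
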